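(* Let $R$ be a binary predicate symbol and let $R_{\mathrm{ref}}$, $R_{\mathrm{irr}}$ be two further distinct binary predicate symbols. Let $N$ be a finite clause set that does not contain the predicates $R_{\mathrm{ref}}$ and $R_{\mathrm{irr}}$. Then $N$ is satisfiable if and only if $\operatorname{rrs}(N)$ is satisfiable, where $\operatorname{rrs}(N)$ is the normal form of $N$ with respect to the rewrite system $\Rightarrow_{\mathrm{RRS}}$.
   Context: We work in first-order logic without equality. A clause is a finite multiset of literals, read as a universally quantified disjunction; clauses are considered up to renaming of variables. The notation $[\neg]A$ denotes either the atom $A$ or its negation (with the same choice on both sides of a rule), $\uplus$ denotes disjoint union, and mgu means most general unifier. The rewrite relation $\Rightarrow_{\mathrm{RRS}}$ on finite clause sets is given by the following three rules. Irreflexive: $N \uplus \{[\neg]R(s,t) \lor C\} \Rightarrow_{\mathrm{RRS}} N \cup \{[\neg]R_{\mathrm{irr}}(s,t)\lor C\}$, provided $s$ and $t$ are not unifiable. Reflexive: $N \uplus \{[\neg]R(s,t) \lor C\} \Rightarrow_{\mathrm{RRS}} N \cup \{[\neg]R_{\mathrm{irr}}(s,t)\lor C,\ [\neg]R_{\mathrm{ref}}(s\sigma,t\sigma)\lor C\sigma\}$, provided $s$ and $t$ are unifiable with mgu $\sigma$. Delete: $N \uplus \{[\neg]R_{\mathrm{irr}}(s,s) \lor C\} \Rightarrow_{\mathrm{RRS}} N$. This rewrite system is terminating and confluent, and $\operatorname{rrs}(N)$ denotes the normal form obtained from $N$ by exhaustively applying $\Rightarrow_{\mathrm{RRS}}$.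 *)

theory Defs
  imports "HOL-Library.Multiset"
begin

section \<open>Terms, substitutions, unifiers\<close>

text \<open>Function and predicate symbols are identified by their name together with their
  number of arguments, so no separate signature is needed.\<close>

datatype 'f trm = Var nat | Fun 'f "'f trm list"

type_synonym 'f subst = "nat \<Rightarrow> 'f trm"

primrec subst :: "'f trm \<Rightarrow> 'f subst \<Rightarrow> 'f trm" (infixl "\<cdot>" 67) where
  "Var x \<cdot> \<sigma> = \<sigma> x"
| "Fun f ts \<cdot> \<sigma> = Fun f (map (\<lambda>t. t \<cdot> \<sigma>) ts)"

definition is_unifier :: "'f subst \<Rightarrow> 'f trm \<Rightarrow> 'f trm \<Rightarrow> bool" where
  "is_unifier \<sigma> s t \<longleftrightarrow> s \<cdot> \<sigma> = t \<cdot> \<sigma>"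

definition unifiable :: "'f trm \<Rightarrow> 'f trm \<Rightarrow> bool" where
  "unifiable s t \<longleftrightarrow> (\<exists>\<sigma>. is_unifier \<sigma> s t)"

definition is_mgu :: "'f subst \<Rightarrow> 'f trm \<Rightarrow> 'f trm \<Rightarrow> bool" where
  "is_mgu \<sigma> s t \<longleftrightarrow>
     is_unifier \<sigma> s t \<and> (\<forall>\<tau>. is_unifier \<tau> s t \<longrightarrow> (\<exists>\<rho>. \<forall>x. \<tau> x = \<sigma> x \<cdot> \<rho>))"

section \<open>Clauses up to renaming\<close>

text \<open>The Boolean is the polarity: \<open>Lit True P ts\<close> is the atom, \<open>Lit False P ts\<close> its negation.\<close>

datatype ('p, 'f) literal = Lit bool 'p "'f trm list"

primrec subst_lit :: "('p, 'f) literal \<Rightarrow> 'f subst \<Rightarrow> ('p, 'f) literal" where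
  "subst_lit (Lit b P ts) \<sigma> = Lit b P (map (\<lambda>t. t \<cdot> \<sigma>) ts)"

definition subst_mset :: "('p, 'f) literal multiset \<Rightarrow> 'f subst \<Rightarrow> ('p, 'f) literal multiset" where
  "subst_mset C \<sigma> = image_mset (\<lambda>L. subst_lit L \<sigma>) C"

definition variant :: "('p, 'f) literal multiset \<Rightarrow> ('p, 'f) literal multiset \<Rightarrow> bool" where
  "variant C D \<longleftrightarrow> (\<exists>\<pi>. bij \<pi> \<and> D = subst_mset C (Var \<circ> \<pi>))"

lemma subst_Var [simp]: "t \<cdot> Var = t"
  by (induction t) (simp_all add: map_idI)

lemma subst_subst: "t \<cdot> \<sigma> \<cdot> \<tau> = t \<cdot> (\<lambda>x. \<sigma> x \<cdot> \<tau>)"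
  by (induction t) simp_all

lemma subst_lit_Var [simp]: "subst_lit L Var = L"
  by (cases L) simp

lemma subst_lit_subst_lit: "subst_lit (subst_lit L \<sigma>) \<tau> = subst_lit L (\<lambda>x. \<sigma> x \<cdot> \<tau>)"
  by (cases L) (simp add: subst_subst)

lemma subst_mset_Var [simp]: "subst_mset C Var = C"
  by (simp add: subst_mset_def)

lemma subst_mset_subst_mset: "subst_mset (subst_mset C \<sigma>) \<tau> = subst_mset C (\<lambda>x. \<sigma> x \<cdot> \<tau>)"
  by (simp add: subst_mset_def subst_lit_subst_lit multiset.map_comp o_def)

lemma equivp_variant: "equivp variant"
proof (rule equivpI)
  have "variant C C" for C :: "('p, 'f) literal multiset"
    unfolding variant_def by (rule exI[of _ id]) simp
  then show "reflp (variant :: ('p, 'f) literal multiset \<Rightarrow> _)" by (rule reflpI)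
next
  have "variant D C" if CD: "variant C D" for C D :: "('p, 'f) literal multiset"
  proof -
    obtain \<pi> where \<pi>: "bij \<pi>" and D: "D = subst_mset C (Var \<circ> \<pi>)"
      using CD unfolding variant_def by blast
    have "subst_mset D (Var \<circ> inv \<pi>) = subst_mset C Var"
      using \<pi> unfolding D subst_mset_subst_mset by (simp add: bij_is_inj)
    then show ?thesis
      using bij_imp_bij_inv[OF \<pi>] unfolding variant_def by (intro exI[of _ "inv \<pi>"]) simp
  qed
  then show "symp (variant :: ('p, 'f) literal multiset \<Rightarrow> _)" by (rule sympI)
next
  have "variant C E" if CD: "variant C D" "variant D E" for C D E :: "('p, 'f) literal multiset"
  proof -
    obtain \<pi> \<pi>' where \<pi>: "bij \<pi>" "bij \<pi>'"
      and D: "D = subst_mset C (Var \<circ> \<pi>)" and E: "E = subst_mset D (Var \<circ> \<pi>')"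
      using CD unfolding variant_def by blast
    have "E = subst_mset C (Var \<circ> (\<pi>' \<circ> \<pi>))"
      unfolding E D subst_mset_subst_mset by (simp add: o_def)
    then show ?thesis using bij_comp[OF \<pi>] unfolding variant_def by blast
  qed
  then show "transp (variant :: ('p, 'f) literal multiset \<Rightarrow> _)" by (rule transpI)
qed

quotient_type ('p, 'f) clause = "('p, 'f) literal multiset" / variant
  morphisms rep_clause mk_clause
  by (rule equivp_variant)

primrec lit_symbol :: "('p, 'f) literal \<Rightarrow> 'p \<times> nat" where
  "lit_symbol (Lit b P ts) = (P, length ts)"

lemma lit_symbol_subst_lit [simp]: "lit_symbol (subst_lit L \<sigma>) = lit_symbol L"
  by (cases L) simp

lift_definition clause_preds :: "('p, 'f) clause \<Rightarrow> ('p \<times> nat) set"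
  is "\<lambda>C. lit_symbol ` set_mset C"
  by (auto simp: variant_def subst_mset_def image_image)

definition preds :: "('p, 'f) clause set \<Rightarrow> ('p \<times> nat) set" where
  "preds N = (\<Union>D\<in>N. clause_preds D)"

section \<open>Semantics\<close>

primrec eval :: "('f \<Rightarrow> 'd list \<Rightarrow> 'd) \<Rightarrow> (nat \<Rightarrow> 'd) \<Rightarrow> 'f trm \<Rightarrow> 'd" where
  "eval F \<beta> (Var x) = \<beta> x"
| "eval F \<beta> (Fun f ts) = F f (map (eval F \<beta>) ts)"

primrec lit_true ::
  "('f \<Rightarrow> 'd list \<Rightarrow> 'd) \<Rightarrow> ('p \<Rightarrow> 'd list \<Rightarrow> bool) \<Rightarrow> (nat \<Rightarrow> 'd) \<Rightarrow> ('p, 'f) literal \<Rightarrow> bool" where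
  "lit_true F I \<beta> (Lit b P ts) \<longleftrightarrow> (I P (map (eval F \<beta>) ts) \<longleftrightarrow> b)"

lemma eval_subst: "eval F \<beta> (t \<cdot> \<sigma>) = eval F (\<lambda>x. eval F \<beta> (\<sigma> x)) t"
  by (induction t) (auto simp: o_def intro!: arg_cong[where f = "F _"])

lemma lit_true_subst_lit:
  "lit_true F I \<beta> (subst_lit L \<sigma>) = lit_true F I (\<lambda>x. eval F \<beta> (\<sigma> x)) L"
  by (cases L) (simp add: eval_subst o_def)

lift_definition clause_true ::
  "('f \<Rightarrow> 'd list \<Rightarrow> 'd) \<Rightarrow> ('p \<Rightarrow> 'd list \<Rightarrow> bool) \<Rightarrow> ('p, 'f) clause \<Rightarrow> bool"
  is "\<lambda>F I C. \<forall>\<beta>. \<exists>L \<in># C. lit_true F I \<beta> L"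
proof -
  fix F :: "'f \<Rightarrow> 'd list \<Rightarrow> 'd" and I :: "'p \<Rightarrow> 'd list \<Rightarrow> bool"
    and C D :: "('p, 'f) literal multiset"
  have *: "\<exists>L \<in># subst_mset C \<sigma>. lit_true F I \<beta> L"
    if "\<forall>\<beta>. \<exists>L \<in># C. lit_true F I \<beta> L"
    for C :: "('p, 'f) literal multiset" and \<sigma> \<beta>
    using that by (auto simp: subst_mset_def lit_true_subst_lit)
  assume "variant C D"
  moreover from this have "variant D C"
    using equivp_symp[OF equivp_variant] by blast
  ultimately show "(\<forall>\<beta>. \<exists>L \<in># C. lit_true F I \<beta> L) = (\<forall>\<beta>. \<exists>L \<in># D. lit_true F I \<beta> L)"
    unfolding variant_def using * by metis
qed

definition models ::
  "('f \<Rightarrow> 'd list \<Rightarrow> 'd) \<Rightarrow> ('p \<Rightarrow> 'd list \<Rightarrow> bool) \<Rightarrow> ('p, 'f) clause set \<Rightarrow> bool" where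
  "models F I N \<longleftrightarrow> (\<forall>D\<in>N. clause_true F I D)"

text \<open>HOL cannot quantify existentially over the type of the domain. Taking \<open>'f trm\<close> as the
  domain (with arbitrary interpretations of the function symbols) loses nothing: by
  \<open>satisfiableI\<close> below, a model over any type whatsoever yields one over \<open>'f trm\<close>.\<close>

definition satisfiable :: "('p, 'f) clause set \<Rightarrow> bool" where
  "satisfiable N \<longleftrightarrow>
     (\<exists>(F :: 'f \<Rightarrow> 'f trm list \<Rightarrow> 'f trm) (I :: 'p \<Rightarrow> 'f trm list \<Rightarrow> bool). models F I N)"

lemma satisfiableI:
  fixes F :: "'f \<Rightarrow> 'd list \<Rightarrow> 'd" and I :: "'p \<Rightarrow> 'd list \<Rightarrow> bool"
  assumes "models F I N"
  shows "satisfiable N"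
proof -
  define \<beta> :: "nat \<Rightarrow> 'd" where "\<beta> = (\<lambda>_. undefined)"
  define J where "J P us = I P (map (eval F \<beta>) us)" for P us
  have eval_Fun: "eval Fun \<sigma> t = t \<cdot> \<sigma>" for \<sigma> :: "'f subst" and t
    by (induction t) (auto intro: map_cong)
  have lit: "lit_true Fun J \<sigma> L = lit_true F I (\<lambda>x. eval F \<beta> (\<sigma> x)) L" for \<sigma> L
    by (cases L) (simp add: J_def eval_Fun eval_subst o_def)
  have "clause_true Fun J D" if "clause_true F I D" for D
    using that unfolding clause_true.rep_eq lit by blast
  with assms have "models Fun J N" by (simp add: models_def)
  then show ?thesis unfolding satisfiable_def by blast
qed

section \<open>The rewrite system\<close>

text \<open>The side conditions \<open>\<notin> N\<close> render the disjoint unions on the left-hand sides.\<close>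

inductive rrs_step ::
  "'p \<Rightarrow> 'p \<Rightarrow> 'p \<Rightarrow> ('p, 'f) clause set \<Rightarrow> ('p, 'f) clause set \<Rightarrow> bool"
  for R Rref Rirr :: 'p where
  irreflexive:
    "mk_clause (add_mset (Lit b R [s, t]) C) \<notin> N \<Longrightarrow> \<not> unifiable s t \<Longrightarrow>
     rrs_step R Rref Rirr
       (N \<union> {mk_clause (add_mset (Lit b R [s, t]) C)})
       (N \<union> {mk_clause (add_mset (Lit b Rirr [s, t]) C)})"
| reflexive:
    "mk_clause (add_mset (Lit b R [s, t]) C) \<notin> N \<Longrightarrow> unifiable s t \<Longrightarrow> is_mgu \<sigma> s t \<Longrightarrow>
     rrs_step R Rref Rirr
       (N \<union> {mk_clause (add_mset (Lit b R [s, t]) C)})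
       (N \<union> {mk_clause (add_mset (Lit b Rirr [s, t]) C),
             mk_clause (add_mset (Lit b Rref [s \<cdot> \<sigma>, t \<cdot> \<sigma>]) (subst_mset C \<sigma>))})"
| delete:
    "mk_clause (add_mset (Lit b Rirr [s, s]) C) \<notin> N \<Longrightarrow>
     rrs_step R Rref Rirr
       (N \<union> {mk_clause (add_mset (Lit b Rirr [s, s]) C)})
       N"

definition rrs_normal_form ::
  "'p \<Rightarrow> 'p \<Rightarrow> 'p \<Rightarrow> ('p, 'f) clause set \<Rightarrow> ('p, 'f) clause set \<Rightarrow> bool" where
  "rrs_normal_form R Rref Rirr N M \<longleftrightarrow>
     (rrs_step R Rref Rirr)\<^sup>*\<^sup>* N M \<and> (\<nexists>M'. rrs_step R Rref Rirr M M')"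

text \<open>For finite \<open>N\<close> and distinct predicates a normal form exists by termination and is unique
  by confluence, so the choice operator selects the only candidate.\<close>

definition rrs :: "'p \<Rightarrow> 'p \<Rightarrow> 'p \<Rightarrow> ('p, 'f) clause set \<Rightarrow> ('p, 'f) clause set" where
  "rrs R Rref Rirr N = (SOME M. rrs_normal_form R Rref Rirr N M)"

end

theory Submission
  imports Defs
begin

text \<open>
  If \<open>N\<close> has a model, interpreting both new predicates as \<open>R\<close> gives a model of every clause set
  reachable from \<open>N\<close>. Conversely, take a Herbrand model \<open>J\<close> of a normal form and read \<open>R(u, v)\<close> as
  \<open>Rref(u, v)\<close> if \<open>u = v\<close> and as \<open>Rirr(u, v)\<close> otherwise. Going back along the rewrite steps, one
  keeps the invariant that every ground instance of a clause is true or contains a literal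
  \<open>[\<not>]Rirr(u, u)\<close>: the latter makes up for deleted clauses, and \<open>N\<close> itself contains no such literal.
  That a normal form exists and is free of \<open>R\<close> needs termination, for which a clause with \<open>k\<close>
  occurrences of \<open>R\<close> is given weight \<open>3 ^ k\<close>, and the existence of most general unifiers.
\<close>

section \<open>Most general unifiers\<close>

primrec vars_trm :: "'f trm \<Rightarrow> nat set" where
  "vars_trm (Var x) = {x}"
| "vars_trm (Fun f ts) = (\<Union>V\<in>set (map vars_trm ts). V)"

definition unifies :: "'f subst \<Rightarrow> ('f trm \<times> 'f trm) list \<Rightarrow> bool" where
  "unifies \<sigma> E \<longleftrightarrow> (\<forall>(s, t)\<in>set E. s \<cdot> \<sigma> = t \<cdot> \<sigma>)"

text \<open>The factor through which a unifier \<open>\<tau>\<close> passes is \<open>\<tau>\<close>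
  itself. This is the idempotent form of most generality; with no existential factor, it composes
  easily along the recursion.\<close>

definition idem_mgu :: "'f subst \<Rightarrow> ('f trm \<times> 'f trm) list \<Rightarrow> bool" where
  "idem_mgu \<sigma> E \<longleftrightarrow> unifies \<sigma> E \<and> (\<forall>\<tau>. unifies \<tau> E \<longrightarrow> (\<forall>x. \<sigma> x \<cdot> \<tau> = \<tau> x))"

lemma unifies_Cons: "unifies \<sigma> ((s, t) # E) \<longleftrightarrow> s \<cdot> \<sigma> = t \<cdot> \<sigma> \<and> unifies \<sigma> E"
  by (simp add: unifies_def)

lemma idem_mgu_cong: "(\<And>\<tau>. unifies \<tau> E \<longleftrightarrow> unifies \<tau> E') \<Longrightarrow> idem_mgu \<sigma> E \<longleftrightarrow> idem_mgu \<sigma> E'"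
  by (simp add: idem_mgu_def)

lemma subst_cong: "(\<And>x. x \<in> vars_trm t \<Longrightarrow> \<sigma> x = \<tau> x) \<Longrightarrow> t \<cdot> \<sigma> = t \<cdot> \<tau>"
  by (induction t) auto

lemma size_subst_var_le: "x \<in> vars_trm t \<Longrightarrow> size (\<tau> x) \<le> size (t \<cdot> \<tau>)"
proof (induction t)
  case (Fun f ts)
  then obtain t where t: "t \<in> set ts" "x \<in> vars_trm t" by auto
  have "size (t \<cdot> \<tau>) \<le> size_list size (map (\<lambda>t. t \<cdot> \<tau>) ts)"
    by (rule size_list_estimation'[of "t \<cdot> \<tau>"]) (use t in auto)
  then show ?case using Fun.IH[OF t] by simp
qed simp

text \<open>If \<open>x\<close> occurred in \<open>t\<close>, then \<open>\<tau> x\<close> would be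
  a proper subterm of the instance of \<open>t\<close>, hence strictly smaller than it.\<close>

lemma occurs_check:
  assumes "\<tau> x = t \<cdot> \<tau>" and "t \<noteq> Var x"
  shows "x \<notin> vars_trm t"
proof
  assume x: "x \<in> vars_trm t"
  then obtain f ts where t: "t = Fun f ts"
    using assms(2) by (cases t) auto
  with x obtain u where u: "u \<in> set ts" "x \<in> vars_trm u" by auto
  have "size (u \<cdot> \<tau>) \<le> size_list size (map (\<lambda>t. t \<cdot> \<tau>) ts)"
    by (rule size_list_estimation'[of "u \<cdot> \<tau>"]) (use u in auto)
  then have "size (\<tau> x) < size (t \<cdot> \<tau>)"
    using size_subst_var_le[OF u(2), of \<tau>] t by simp
  then show False using assms(1) by simp
qed

text \<open>A substitution that already solves \<open>x = t\<close> cannot see the replacement of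
  \<open>x\<close> by \<open>t\<close>. Hence elimination keeps both the unifiers and the size of
  the instances.\<close>

lemma subst_upd_unifier: "\<tau> x = t \<cdot> \<tau> \<Longrightarrow> s \<cdot> Var(x := t) \<cdot> \<tau> = s \<cdot> \<tau>"
  unfolding subst_subst by (rule subst_cong) simp

text \<open>As \<open>x\<close> is not in \<open>t\<close>, the binding fixes \<open>t\<close>, so
  the composed substitution solves the first equation. Any unifier of the whole list absorbs first
  \<open>\<sigma>\<close> and then the binding.\<close>

lemma idem_mgu_eliminate:
  fixes E :: "('f trm \<times> 'f trm) list"
  assumes x: "x \<notin> vars_trm t"
    and \<sigma>: "idem_mgu \<sigma> (map (\<lambda>(u, v). (u \<cdot> Var(x := t), v \<cdot> Var(x := t))) E)"
  shows "idem_mgu (\<lambda>y. (Var(x := t)) y \<cdot> \<sigma>) ((Var x, t) # E)"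
proof -
  let ?E = "map (\<lambda>(u, v). (u \<cdot> Var(x := t), v \<cdot> Var(x := t))) E"
  have t: "t \<cdot> Var(x := t) = t"
    using x subst_cong[of t "Var(x := t)" Var] by (metis fun_upd_other subst_Var)
  have "unifies \<sigma> ?E" using \<sigma> by (simp add: idem_mgu_def)
  then have "unifies (\<lambda>y. (Var(x := t)) y \<cdot> \<sigma>) E"
    by (auto simp: unifies_def subst_subst[symmetric] simp del: fun_upd_apply)
  moreover have "t \<cdot> (\<lambda>y. (Var(x := t)) y \<cdot> \<sigma>) = t \<cdot> \<sigma>"
    by (simp only: subst_subst[symmetric] t)
  ultimately have "unifies (\<lambda>y. (Var(x := t)) y \<cdot> \<sigma>) ((Var x, t) # E)"
    by (simp add: unifies_Cons)
  moreover have "(Var(x := t)) y \<cdot> \<sigma> \<cdot> \<tau> = \<tau> y" if \<tau>: "unifies \<tau> ((Var x, t) # E)" for \<tau> y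
  proof -
    have \<tau>x: "\<tau> x = t \<cdot> \<tau>" using \<tau> by (simp add: unifies_Cons)
    have "unifies \<tau> ?E"
      using \<tau> by (auto simp: unifies_def subst_upd_unifier[OF \<tau>x])
    then have "\<sigma> z \<cdot> \<tau> = \<tau> z" for z using \<sigma> by (simp add: idem_mgu_def)
    then show ?thesis using \<tau>x by (simp add: subst_subst)
  qed
  ultimately show ?thesis by (simp add: idem_mgu_def)
qed

text \<open>The size of the equations instantiated by a fixed unifier \<open>\<tau>\<close> decreases even under variable
  elimination, which does not change the instances; no variables need to be counted.\<close>

lemma idem_mgu_exists:
  fixes E :: "('f trm \<times> 'f trm) list"
  assumes "unifies \<tau> E"
  shows "\<exists>\<sigma>. idem_mgu \<sigma> E"
  using assms
proof (induction E rule: measure_induct_rule[where f = "size_list (\<lambda>(s, t). size (s \<cdot> \<tau>))"])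
  case (less E)
  let ?m = "size_list (\<lambda>(s, t). size (s \<cdot> \<tau>))"
  \<comment> \<open>This serves both orientations of an equation with a variable side. The trivial
    equation is dropped, since the occurs check excludes it.\<close>
  have eliminate: "\<exists>\<sigma>. idem_mgu \<sigma> ((Var x, t) # E')"
    if \<tau>x: "\<tau> x = t \<cdot> \<tau>" and E': "unifies \<tau> E'" "?m E' < ?m E" for x t E'
  proof (cases "t = Var x")
    case True
    then show ?thesis using less.IH[OF E'(2,1)]
      by (auto simp: unifies_Cons cong: idem_mgu_cong
          intro: idem_mgu_cong[THEN iffD1, rotated])
  next
    case False
    let ?E = "map (\<lambda>(u, v). (u \<cdot> Var(x := t), v \<cdot> Var(x := t))) E'"
    have "?m ?E = ?m E'"
      using subst_upd_unifier[where \<tau> = \<tau>, OF \<tau>x]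
      by (simp add: o_def case_prod_unfold del: fun_upd_apply)
    moreover have "unifies \<tau> ?E"
      using E'(1) by (auto simp: unifies_def subst_upd_unifier[where \<tau> = \<tau>, OF \<tau>x])
    ultimately obtain \<sigma> where "idem_mgu \<sigma> ?E"
      using less.IH[of ?E] E'(2) by auto
    then show ?thesis
      using idem_mgu_eliminate[OF occurs_check[where \<tau> = \<tau>, OF \<tau>x False]] by blast
  qed
  show ?case
  proof (cases E)
    case Nil
    then show ?thesis by (intro exI[of _ Var]) (simp add: idem_mgu_def unifies_def)
  next
    case (Cons e E')
    obtain s t where E: "E = (s, t) # E'" using Cons by (cases e) auto
    have eq: "s \<cdot> \<tau> = t \<cdot> \<tau>" and E': "unifies \<tau> E'" "?m E' < ?m E"
      using less.prems E by (simp_all add: unifies_Cons)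
    show ?thesis
    proof (cases s)
      case (Var x)
      then show ?thesis using eliminate[of x t E'] eq E' E by simp
    next
      case s: (Fun f ss)
      show ?thesis
      proof (cases t)
        case (Var x)
        have "idem_mgu \<sigma> E \<longleftrightarrow> idem_mgu \<sigma> ((Var x, s) # E')" for \<sigma>
          using Var E by (intro idem_mgu_cong) (auto simp: unifies_Cons)
        then show ?thesis using eliminate[of x s E'] eq E' Var by simp
      next
        case t: (Fun g ts)
        have fg: "f = g" and args: "map (\<lambda>s. s \<cdot> \<tau>) ss = map (\<lambda>t. t \<cdot> \<tau>) ts"
          using eq s t by simp_all
        have len: "length ss = length ts" using map_eq_imp_length_eq[OF args] .
        have unif: "unifies \<rho> E \<longleftrightarrow> unifies \<rho> (zip ss ts @ E')" for \<rho>
        proof -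
          have "map (\<lambda>s. s \<cdot> \<rho>) ss = map (\<lambda>t. t \<cdot> \<rho>) ts \<longleftrightarrow> unifies \<rho> (zip ss ts)"
            using len by (induction ss ts rule: list_induct2) (auto simp: unifies_def)
          then show ?thesis by (auto simp: E s t fg unifies_def)
        qed
        \<comment> \<open>The measure sees left sides only and adds one per equation, just as
          \<open>size_list\<close> does for arguments; the contribution of the head symbol is what
          disappears.\<close>
        have "?m (zip ss ts) = size_list size (map (\<lambda>s. s \<cdot> \<tau>) ss)"
          using len by (induction ss ts rule: list_induct2) auto
        then have "?m (zip ss ts @ E') < ?m E"
          by (simp add: E s size_list_append)
        then show ?thesis
          using less.IH less.prems unif idem_mgu_cong[OF unif] by blast
      qed
    qed
  qed
qed

lemma mgu_exists:
  assumes "unifiable s t"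
  shows "\<exists>\<sigma>. is_mgu \<sigma> s t"
proof -
  obtain \<sigma> where \<sigma>: "idem_mgu \<sigma> [(s, t)]"
    using assms idem_mgu_exists[of _ "[(s, t)]"]
    by (auto simp: unifiable_def is_unifier_def unifies_def)
  then have "is_mgu \<sigma> s t"
    unfolding is_mgu_def idem_mgu_def unifies_def is_unifier_def by auto metis
  then show ?thesis by blast
qed

section \<open>Normal forms\<close>

lift_definition symbol_count :: "'p \<times> nat \<Rightarrow> ('p, 'f) clause \<Rightarrow> nat"
  is "\<lambda>p C. size {#L \<in># C. lit_symbol L = p#}"
  by (auto simp: variant_def subst_mset_def filter_mset_image_mset)

lemma symbol_count_mk:
  "symbol_count p (mk_clause C) = size {#L \<in># C. lit_symbol L = p#}"
  by (simp add: symbol_count.abs_eq)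

lemma clause_preds_mk: "clause_preds (mk_clause C) = lit_symbol ` set_mset C"
  by (simp add: clause_preds.abs_eq)

definition weight :: "'p \<Rightarrow> ('p, 'f) clause set \<Rightarrow> nat" where
  "weight R N = (\<Sum>D\<in>N. 3 ^ symbol_count (R, 2) D)"

lemma weight_insert: "finite N \<Longrightarrow> D \<notin> N \<Longrightarrow> weight R (insert D N) = 3 ^ symbol_count (R, 2) D + weight R N"
  by (simp add: weight_def)

text \<open>Only an inequality, because a clause produced by a rule may already be present.\<close>

lemma weight_insert_le: "finite N \<Longrightarrow> weight R (insert D N) \<le> 3 ^ symbol_count (R, 2) D + weight R N"
  by (cases "D \<in> N") (simp_all add: weight_insert insert_absorb)

lemma symbol_count_subst:
  "symbol_count p (mk_clause (subst_mset C \<sigma>)) = symbol_count p (mk_clause C)"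
  by (simp add: symbol_count_mk subst_mset_def filter_mset_image_mset)

lemma symbol_count_add:
  "symbol_count p (mk_clause (add_mset L C)) =
     (if lit_symbol L = p then 1 else 0) + symbol_count p (mk_clause C)"
  by (simp add: symbol_count_mk)

text \<open>With \<open>k\<close> occurrences of \<open>R\<close> in \<open>C\<close>, weight
  \<open>3 * 3 ^ k\<close> is traded for at most \<open>2 * 3 ^ k\<close>; base 2 would allow
  equality in the reflexive rule. Deletion removes a positive weight.\<close>

lemma rrs_step_weight:
  assumes "rrs_step R Rref Rirr N M" and "finite N" and "R \<noteq> Rref" and "R \<noteq> Rirr"
  shows "finite M \<and> weight R M < weight R N"
  using assms
proof (induction rule: rrs_step.induct)
  case (irreflexive b s t C N)
  let ?k = "symbol_count (R, 2) (mk_clause C)"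
  have "weight R (N \<union> {mk_clause (add_mset (Lit b Rirr [s, t]) C)}) \<le> 3 ^ ?k + weight R N"
    using weight_insert_le[of N R "mk_clause (add_mset (Lit b Rirr [s, t]) C)"] irreflexive
    by (simp add: symbol_count_add)
  moreover have "weight R (N \<union> {mk_clause (add_mset (Lit b R [s, t]) C)}) = 3 * 3 ^ ?k + weight R N"
    using irreflexive by (simp add: weight_insert symbol_count_add)
  moreover have "(3::nat) ^ ?k > 0" by simp
  ultimately have "weight R (N \<union> {mk_clause (add_mset (Lit b Rirr [s, t]) C)})
      < weight R (N \<union> {mk_clause (add_mset (Lit b R [s, t]) C)})"
    by linarith
  then show ?case using irreflexive.prems(1) by simp
next
  case (reflexive b s t C N \<sigma>)
  let ?k = "symbol_count (R, 2) (mk_clause C)"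
  let ?D = "mk_clause (add_mset (Lit b Rirr [s, t]) C)"
  let ?D' = "mk_clause (add_mset (Lit b Rref [s \<cdot> \<sigma>, t \<cdot> \<sigma>]) (subst_mset C \<sigma>))"
  have "weight R (N \<union> {?D, ?D'}) \<le> 3 ^ ?k + (3 ^ ?k + weight R N)"
    using weight_insert_le[of "insert ?D' N" R ?D] weight_insert_le[of N R ?D'] reflexive
    by (simp add: symbol_count_add symbol_count_subst)
  moreover have "weight R (N \<union> {mk_clause (add_mset (Lit b R [s, t]) C)}) = 3 * 3 ^ ?k + weight R N"
    using reflexive by (simp add: weight_insert symbol_count_add)
  moreover have "(3::nat) ^ ?k > 0" by simp
  ultimately have "weight R (N \<union> {?D, ?D'})
      < weight R (N \<union> {mk_clause (add_mset (Lit b R [s, t]) C)})"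
    by linarith
  then show ?case using reflexive.prems(1) by simp
next
  case (delete b s C N)
  then show ?case by (simp add: weight_insert)
qed

lemma rrs_normal_form_exists:
  assumes "finite N" and "R \<noteq> Rref" and "R \<noteq> Rirr"
  shows "\<exists>M. rrs_normal_form R Rref Rirr N M"
  using assms(1)
proof (induction N rule: measure_induct_rule[where f = "weight R"])
  case (less N)
  show ?case
  proof (cases "\<exists>M. rrs_step R Rref Rirr N M")
    case True
    then obtain M where M: "rrs_step R Rref Rirr N M" ..
    then obtain M' where "rrs_normal_form R Rref Rirr M M'"
      using less rrs_step_weight assms(2,3) by metis
    then show ?thesis using M
      by (auto simp: rrs_normal_form_def intro: converse_rtranclp_into_rtranclp)
  qed (auto simp: rrs_normal_form_def)
qed

lemma rrs_normal_form_rrs: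
  assumes "finite N" and "R \<noteq> Rref" and "R \<noteq> Rirr"
  shows "rrs_normal_form R Rref Rirr N (rrs R Rref Rirr N)"
  unfolding rrs_def using rrs_normal_form_exists[OF assms] by (rule someI_ex)

lemma mk_clause_cases: obtains C where "D = mk_clause C"
  by (metis Quotient_clause Quotient_abs_rep)

text \<open>Every binary \<open>R\<close> literal is a redex: its arguments are either not unifiable
  or have a most general unifier.\<close>

lemma irreducible_preds:
  assumes "\<nexists>M'. rrs_step R Rref Rirr M M'"
  shows "(R, 2) \<notin> preds M"
proof
  assume "(R, 2) \<in> preds M"
  then obtain D where D: "D \<in> M" "(R, 2) \<in> clause_preds D" by (auto simp: preds_def)
  obtain C where C: "D = mk_clause C" by (rule mk_clause_cases)
  obtain L where L: "L \<in># C" "lit_symbol L = (R, 2)" using D(2) C by (auto simp: clause_preds_mk)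
  obtain b ts where "L = Lit b R ts" "length ts = 2" using L(2) by (cases L) auto
  then obtain s t where "L = Lit b R [s, t]"
    by (auto simp: numeral_2_eq_2 length_Suc_conv)
  then obtain C' where "D = mk_clause (add_mset (Lit b R [s, t]) C')"
    using L(1) C by (metis insert_DiffM)
  moreover have "M = (M - {D}) \<union> {D}" using D(1) by blast
  moreover have "D \<notin> M - {D}" by simp
  ultimately have "\<exists>M'. rrs_step R Rref Rirr M M'"
    by (metis mgu_exists rrs_step.irreflexive rrs_step.reflexive)
  then show False using assms by blast
qed

section \<open>Preservation of satisfiability\<close>

lemma clause_true_mk:
  "clause_true F I (mk_clause C) \<longleftrightarrow> (\<forall>\<beta>. \<exists>L\<in>#C. lit_true F I \<beta> L)"
  by (simp add: clause_true.abs_eq)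

lemma clause_true_cong:
  assumes "\<And>P ts. (P, length ts) \<in> clause_preds D \<Longrightarrow> I P ts = J P ts"
  shows "clause_true F I D \<longleftrightarrow> clause_true F J D"
proof -
  obtain C where D: "D = mk_clause C" by (rule mk_clause_cases)
  have "lit_true F I \<beta> L \<longleftrightarrow> lit_true F J \<beta> L" if "L \<in># C" for \<beta> L
    using assms that D by (cases L) (force simp: clause_preds_mk)
  then show ?thesis by (simp add: D clause_true_mk)
qed

lemma models_cong:
  assumes "\<And>P ts. (P, length ts) \<in> preds N \<Longrightarrow> I P ts = J P ts"
  shows "models F I N \<longleftrightarrow> models F J N"
  unfolding models_def using assms by (intro ball_cong clause_true_cong) (auto simp: preds_def)

text \<open>When both new predicates are read as \<open>R\<close>, each added clause says the same
  as the replaced clause or as an instance of it.\<close>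

lemma rrs_step_sound:
  assumes "rrs_step R Rref Rirr N M" and "models F I N"
    and "\<And>u v. I Rref [u, v] = I R [u, v]" and "\<And>u v. I Rirr [u, v] = I R [u, v]"
  shows "models F I M"
  using assms
proof (induction rule: rrs_step.induct)
  case (reflexive b s t C N \<sigma>)
  have "\<forall>\<beta>. \<exists>L\<in>#add_mset (Lit b R [s, t]) C. lit_true F I \<beta> L"
    using reflexive.prems by (simp add: models_def clause_true_mk)
  then have "\<exists>L\<in>#add_mset (Lit b R [s, t]) C. lit_true F I \<beta> (subst_lit L \<sigma>)" for \<beta>
    by (simp only: lit_true_subst_lit)
  then show ?case using reflexive.prems
    by (simp add: models_def clause_true_mk subst_mset_def)
qed (simp_all add: models_def clause_true_mk)

lemma satisfiable_forward:
  fixes N M :: "('p, 'f) clause set"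
  assumes N: "satisfiable N" and steps: "(rrs_step R Rref Rirr)\<^sup>*\<^sup>* N M"
    and "(Rref, 2) \<notin> preds N" and "(Rirr, 2) \<notin> preds N"
  shows "satisfiable M"
proof -
  obtain F :: "'f \<Rightarrow> 'f trm list \<Rightarrow> 'f trm" and I where FI: "models F I N"
    using N by (auto simp: satisfiable_def)
  \<comment> \<open>The length guard matters: the same names may occur in \<open>N\<close> with
    other arities.\<close>
  define J where "J P ts = I (if P \<in> {Rref, Rirr} \<and> length ts = 2 then R else P) ts" for P ts
  have J: "models F J N"
    using FI assms(3,4) by (subst models_cong[of N J I]) (auto simp: J_def)
  have "models F J M"
    using steps
  proof (induction rule: rtranclp_induct)
    case (step M M')
    show ?case by (rule rrs_step_sound[OF step(2,3)]) (simp_all add: J_def)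
  qed (rule J)
  then show ?thesis by (rule satisfiableI)
qed

section \<open>Backward direction: Herbrand models and weak truth\<close>

lemma eval_Fun: "eval Fun \<sigma> t = t \<cdot> \<sigma>"
  by (induction t) (auto intro: map_cong)

text \<open>Over terms, equality of values is syntactic identity, so values of non-unifiable terms
  never coincide. In an arbitrary model they might.\<close>

lemma satisfiable_Herbrand:
  fixes N :: "('p, 'f) clause set"
  assumes "satisfiable N"
  obtains I where "models Fun I N"
proof -
  obtain F :: "'f \<Rightarrow> 'f trm list \<Rightarrow> 'f trm" and I where FI: "models F I N"
    using assms by (auto simp: satisfiable_def)
  \<comment> \<open>\<open>Var\<close> acts here as one arbitrary assignment into the domain of
    \<open>F\<close>, which happens to consist of terms.\<close>
  define J where "J P us = I P (map (eval F Var) us)" for P us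
  have "lit_true Fun J \<sigma> L = lit_true F I (\<lambda>x. eval F Var (\<sigma> x)) L" for \<sigma> L
    by (cases L) (simp add: J_def eval_Fun eval_subst o_def)
  then have "models Fun J N"
    using FI unfolding models_def clause_true.rep_eq by metis
  then show ?thesis by (rule that)
qed

text \<open>Truth of all ground instances, except those that contain a literal \<open>[\<not>]Q(u, u)\<close>. The variables
  of the terms in the range of \<open>\<beta>\<close> play the role of constants.\<close>

definition ground_true ::
  "'p \<Rightarrow> ('p \<Rightarrow> 'f trm list \<Rightarrow> bool) \<Rightarrow> 'f subst \<Rightarrow> ('p, 'f) literal \<Rightarrow> bool" where
  "ground_true Q I \<beta> L \<longleftrightarrow> lit_true Fun I \<beta> L \<or> (\<exists>b u. subst_lit L \<beta> = Lit b Q [u, u])"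

lemma ground_true_subst_lit:
  "ground_true Q I \<beta> (subst_lit L \<sigma>) = ground_true Q I (\<lambda>x. \<sigma> x \<cdot> \<beta>) L"
  by (simp add: ground_true_def lit_true_subst_lit subst_lit_subst_lit eval_Fun)

lift_definition weakly_true ::
  "'p \<Rightarrow> ('p \<Rightarrow> 'f trm list \<Rightarrow> bool) \<Rightarrow> ('p, 'f) clause \<Rightarrow> bool"
  is "\<lambda>Q I C. \<forall>\<beta>. \<exists>L \<in># C. ground_true Q I \<beta> L"
proof -
  fix Q :: 'p and I :: "'p \<Rightarrow> 'f trm list \<Rightarrow> bool" and C D :: "('p, 'f) literal multiset"
  have *: "\<forall>\<beta>. \<exists>L \<in># subst_mset C \<sigma>. ground_true Q I \<beta> L"
    if "\<forall>\<beta>. \<exists>L \<in># C. ground_true Q I \<beta> L" for C :: "('p, 'f) literal multiset" and \<sigma>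
    using that by (auto simp: subst_mset_def ground_true_subst_lit)
  assume "variant C D"
  moreover from this have "variant D C"
    using equivp_symp[OF equivp_variant] by blast
  ultimately show "(\<forall>\<beta>. \<exists>L \<in># C. ground_true Q I \<beta> L) = (\<forall>\<beta>. \<exists>L \<in># D. ground_true Q I \<beta> L)"
    unfolding variant_def using * by metis
qed

lemma weakly_true_mk:
  "weakly_true Q I (mk_clause C) \<longleftrightarrow> (\<forall>\<beta>. \<exists>L\<in>#C. ground_true Q I \<beta> L)"
  by (simp add: weakly_true.abs_eq)

lemma clause_true_imp_weakly_true: "clause_true Fun I D \<Longrightarrow> weakly_true Q I D"
  by (rule mk_clause_cases[of D]) (auto simp: clause_true_mk weakly_true_mk ground_true_def)

text \<open>Instantiation keeps predicate symbols, so the exceptional literal would need a binary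
  \<open>Q\<close> in \<open>D\<close>.\<close>

lemma weakly_true_imp_clause_true:
  assumes "weakly_true Q I D" and "(Q, 2) \<notin> clause_preds D"
  shows "clause_true Fun I D"
proof -
  obtain C where D: "D = mk_clause C" by (rule mk_clause_cases)
  have "lit_true Fun I \<beta> L" if L: "L \<in># C" and g: "ground_true Q I \<beta> L" for \<beta> L
  proof -
    have "lit_symbol (subst_lit L \<beta>) \<noteq> (Q, 2)"
      using assms(2) L D by (force simp: clause_preds_mk)
    then show ?thesis using g by (auto simp: ground_true_def simp del: lit_symbol_subst_lit)
  qed
  then show ?thesis using assms(1) by (auto simp: D clause_true_mk weakly_true_mk) blast
qed

lemma rrs_step_complete:
  fixes N M :: "('p, 'f) clause set"
  assumes "rrs_step R Rref Rirr N M" and "\<forall>D\<in>M. weakly_true Rirr I D"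
    and "Rref \<noteq> Rirr"
    and eq: "\<And>u. I R [u, u] = I Rref [u, u]"
    and neq: "\<And>u v. u \<noteq> v \<Longrightarrow> I R [u, v] = I Rirr [u, v]"
  shows "\<forall>D\<in>N. weakly_true Rirr I D"
  using assms(1-3)
proof (induction rule: rrs_step.induct)
  case (irreflexive b s t C N)
  have "\<exists>L\<in>#add_mset (Lit b R [s, t]) C. ground_true Rirr I \<beta> L" for \<beta>
  proof -
    \<comment> \<open>Otherwise \<open>\<beta>\<close> would be a unifier. Distinct arguments also
      rule out the exception for the \<open>Rirr\<close> literal, whose truth then passes to
      \<open>R\<close>.\<close>
    have "s \<cdot> \<beta> \<noteq> t \<cdot> \<beta>"
      using irreflexive by (auto simp: unifiable_def is_unifier_def)
    moreover have "\<exists>L\<in>#add_mset (Lit b Rirr [s, t]) C. ground_true Rirr I \<beta> L"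
      using irreflexive.prems by (simp add: weakly_true_mk)
    ultimately show ?thesis by (auto simp: ground_true_def eval_Fun neq)
  qed
  then show ?case using irreflexive.prems by (simp add: weakly_true_mk)
next
  case (reflexive b s t C N \<sigma>)
  have "\<exists>L\<in>#add_mset (Lit b R [s, t]) C. ground_true Rirr I \<beta> L" for \<beta>
  proof (cases "s \<cdot> \<beta> = t \<cdot> \<beta>")
    case True
    \<comment> \<open>Here \<open>\<beta>\<close> unifies \<open>s\<close> and \<open>t\<close>, so
      it factors through \<open>\<sigma>\<close>, and the \<open>\<rho>\<close> instance of the
      added \<open>Rref\<close> clause is the \<open>\<beta>\<close> instance sought.\<close>
    then obtain \<rho> where \<rho>: "\<beta> = (\<lambda>x. \<sigma> x \<cdot> \<rho>)"
      using reflexive.hyps(3) by (auto simp: is_mgu_def is_unifier_def fun_eq_iff)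
    have "\<exists>L\<in>#add_mset (Lit b Rref [s, t]) C. ground_true Rirr I \<rho> (subst_lit L \<sigma>)"
      using reflexive.prems by (simp add: weakly_true_mk subst_mset_def)
    then have "\<exists>L\<in>#add_mset (Lit b Rref [s, t]) C. ground_true Rirr I \<beta> L"
      by (simp only: ground_true_subst_lit \<rho>)
    then show ?thesis using True reflexive.prems
      by (auto simp: ground_true_def eval_Fun eq)
  next
    case False
    moreover have "\<exists>L\<in>#add_mset (Lit b Rirr [s, t]) C. ground_true Rirr I \<beta> L"
      using reflexive.prems by (simp add: weakly_true_mk)
    ultimately show ?thesis by (auto simp: ground_true_def eval_Fun neq)
  qed
  then show ?case using reflexive.prems by (simp add: weakly_true_mk)
next
  \<comment> \<open>The literal \<open>Rirr(s, s)\<close> of the deleted clause meets the exception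
    under every \<open>\<beta>\<close>.\<close>
  case (delete b s C N)
  then show ?case by (simp add: weakly_true_mk ground_true_def)
qed

lemma satisfiable_backward:
  fixes N M :: "('p, 'f) clause set"
  assumes M: "satisfiable M" and nf: "rrs_normal_form R Rref Rirr N M"
    and dist: "R \<noteq> Rref" "R \<noteq> Rirr" "Rref \<noteq> Rirr"
    and irr: "(Rirr, 2) \<notin> preds N"
  shows "satisfiable N"
proof -
  obtain J where J: "models Fun J M" using M by (rule satisfiable_Herbrand)
  define I where "I P ts =
    J (if P = R \<and> length ts = 2 then if ts ! 0 = ts ! 1 then Rref else Rirr else P) ts" for P ts
  \<comment> \<open>Since \<open>R\<close> is gone from the normal form, reinterpreting it does no
    harm there.\<close>
  have "(R, 2) \<notin> preds M"
    using nf irreducible_preds[of R Rref Rirr M] by (simp add: rrs_normal_form_def)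
  then have "models Fun I M"
    using J by (subst models_cong[of M I J]) (auto simp: I_def)
  then have M_true: "\<forall>D\<in>M. weakly_true Rirr I D"
    by (simp add: models_def clause_true_imp_weakly_true)
  have "(rrs_step R Rref Rirr)\<^sup>*\<^sup>* N M"
    using nf by (simp add: rrs_normal_form_def)
  then have "\<forall>D\<in>N. weakly_true Rirr I D"
  proof (induction rule: converse_rtranclp_induct)
    case (step N N')
    show ?case
      by (rule rrs_step_complete[OF step(1,3) dist(3)]) (use dist in \<open>simp_all add: I_def\<close>)
  qed (rule M_true)
  \<comment> \<open>Intermediate sets may contain \<open>Rirr\<close>, so only weak truth travels
    back; at \<open>N\<close> it becomes truth.\<close>
  then have "models Fun I N"
    using irr by (auto simp: models_def preds_def intro: weakly_true_imp_clause_true)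
  then show ?thesis by (rule satisfiableI)
qed

theorem lemma10:
  fixes R Rref Rirr :: 'p and N :: "('p, 'f) clause set"
  assumes "R \<noteq> Rref" and "R \<noteq> Rirr" and "Rref \<noteq> Rirr"
    and "finite N"
    and "(Rref, 2) \<notin> preds N" and "(Rirr, 2) \<notin> preds N"
  shows "satisfiable N \<longleftrightarrow> satisfiable (rrs R Rref Rirr N)"
proof -
  have nf: "rrs_normal_form R Rref Rirr N (rrs R Rref Rirr N)"
    using assms(4,1,2) by (rule rrs_normal_form_rrs)
  then have "(rrs_step R Rref Rirr)\<^sup>*\<^sup>* N (rrs R Rref Rirr N)"
    by (simp add: rrs_normal_form_def)
  then show ?thesis
    using satisfiable_forward[OF _ _ assms(5,6)]
      satisfiable_backward[OF _ nf assms(1-3,6)] by blast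
qed

end
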